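(* Let $\lambda>0$ be a rational number and let $(b_n)_{n\geq 1}$ be the eventually greedy best sequence for $\lambda$ described in the context. Then every sequence of integers $(a_n)_{n\geq 1}$ satisfying \[ 2\leq a_1\leq a_2\leq a_3\leq\cdots,\qquad \sum_{n=1}^{\infty}\frac1{a_n}=\lambda \] has one of the following two properties: \[ \liminf_{n\to\infty}a_n^{2^{-n}}<\lim_{n\to\infty}b_n^{2^{-n}} \] or \[ a_n=b_n\quad\text{for all sufficiently large } n . \]
   Context: $\mathbb{N}=\{1,2,\ldots\}$. For $n\geq 1$ let $\mathcal{E}_n^{\leq}=\{(a_1,\ldots,a_n)\in\mathbb{N}^n: 2\leq a_1\leq\cdots\leq a_n\}$, and for real $\lambda>0$ let \[ R_n^{\leq}(\lambda)=\max\Bigl\{\sum_{i=1}^n\frac1{a_i}:\ (a_1,\ldots,a_n)\in\mathcal{E}_n^{\leq},\ \sum_{i=1}^n\frac1{a_i}<\lambda\Bigr\} \] (the maximum is known to exist). A tuple in $\mathcal{E}_n^{\leq}$ attaining this maximum is called a maximizing $n$-term denominator tuple. The sequence $(b_n)$: for every positive rational $\lambda$ the paper constructs an integer $N\geq 1$, a maximizing tuple $(b_1,\ldots,b_N)$ for $R_N^{\leq}(\lambda)$, and an integer $T_0\geq 2$ such that $\lambda=\sum_{i=1}^N 1/b_i+1/T_0$ and such that the following holds. Define $T_{j+1}=T_j(T_j+1)$ for $j\geq 0$ and extend $b_1,\ldots,b_N$ to an infinite sequence by $b_{N+j+1}=T_j+1$ for $j\geq 0$; then $\sum_{n=1}^\infty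 1/b_n=\lambda$ and $\sum_{i=1}^n 1/b_i=R_n^{\leq}(\lambda)$ for every $n\geq N$. The sequence $(b_n)_{n\geq 1}$ so obtained is the eventually greedy best sequence for $\lambda$. The limit $\lim_{n\to\infty}b_n^{2^{-n}}$ exists and is finite and strictly positive. *)

theory Defs
  imports "HOL-Analysis.Analysis"
begin

text \<open>
  Sequences and tuples are indexed from 1. An \<open>n\<close>-tuple is a function \<open>nat \<Rightarrow> nat\<close> of which only
  the values at \<open>1, \<dots>, n\<close> matter; all other values, in particular the one at 0, are unconstrained.
\<close>

definition denom_tuples :: "nat \<Rightarrow> (nat \<Rightarrow> nat) set" where
  "denom_tuples n =
     {a. (\<forall>i\<in>{1..n}. 2 \<le> a i) \<and> (\<forall>i\<in>{1..n}. \<forall>j\<in>{1..n}. i \<le> j \<longrightarrow> a i \<le> a j)}"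

definition usum :: "(nat \<Rightarrow> nat) \<Rightarrow> nat \<Rightarrow> real" where
  "usum a n = (\<Sum>i=1..n. 1 / real (a i))"

text \<open>
  The set of admissible sums is infinite in general, so \<open>Max\<close> is not applicable;
  \<open>GREATEST\<close> is its greatest element, which exists by \<open>best_under_max\<close> below.
\<close>

definition best_under :: "nat \<Rightarrow> real \<Rightarrow> real" where
  "best_under n lam = (GREATEST s. \<exists>a\<in>denom_tuples n. s = usum a n \<and> usum a n < lam)"

definition maximizing_tuple :: "nat \<Rightarrow> real \<Rightarrow> (nat \<Rightarrow> nat) \<Rightarrow> bool" where
  "maximizing_tuple n lam a \<longleftrightarrow>
     a \<in> denom_tuples n \<and> usum a n < lam \<and> usum a n = best_under n lam"

primrec greedy_tail :: "nat \<Rightarrow> nat \<Rightarrow> nat" where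
  "greedy_tail t 0 = t"
| "greedy_tail t (Suc j) = greedy_tail t j * (greedy_tail t j + 1)"

text \<open>
  The terms beyond any index from which two such sequences are both greedy are equal to
  \<open>1 / (best_under n lam - best_under (n - 1) lam)\<close>, so the sequence is determined by \<open>lam\<close>
  up to finitely many terms. That the series of reciprocals has sum \<open>lam\<close>, and that the limit
  of \<open>b n powr (1 / 2 ^ n)\<close> exists and is positive, are consequences of the definition: see
  \<open>eventually_greedy_best_sums\<close> and \<open>eventually_greedy_best_limit\<close>.
\<close>

definition eventually_greedy_best :: "real \<Rightarrow> (nat \<Rightarrow> nat) \<Rightarrow> bool" where
  "eventually_greedy_best lam b \<longleftrightarrow>
     (\<exists>N T0. 1 \<le> N \<and> 2 \<le> T0 \<and>
        maximizing_tuple N lam b \<and>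
        lam = usum b N + 1 / real T0 \<and>
        (\<forall>j. b (N + j + 1) = greedy_tail T0 j + 1) \<and>
        (\<forall>n\<ge>N. usum b n = best_under n lam))"

definition no_inc :: "real set \<Rightarrow> bool" where
  "no_inc A \<longleftrightarrow> \<not> (\<exists>f::nat \<Rightarrow> real. strict_mono f \<and> range f \<subseteq> A)"

lemma no_inc_subset: "no_inc A \<Longrightarrow> B \<subseteq> A \<Longrightarrow> no_inc B"
  unfolding no_inc_def by (meson order_trans)

lemma no_inc_max:
  assumes "no_inc A" "S \<subseteq> A" "S \<noteq> {}"
  shows "\<exists>m\<in>S. \<forall>x\<in>S. x \<le> m"
proof (rule ccontr)
  assume *: "\<not> ?thesis"
  have "\<exists>f. \<forall>n::nat. f n \<in> S \<and> f n < f (Suc n)"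
    by (rule dependent_nat_choice) (use * assms(3) in \<open>force simp: not_le\<close>)+
  then obtain f where f: "\<And>n::nat. f n \<in> S" "\<And>n. f n < f (Suc n)" by auto
  then have "strict_mono f" by (simp add: strict_mono_Suc_iff)
  with f(1) assms(1,2) show False unfolding no_inc_def by blast
qed

lemma no_inc_plus:
  assumes A: "no_inc A" and B: "no_inc B"
  shows "no_inc {x + y |x y. x \<in> A \<and> y \<in> B}"
  unfolding no_inc_def
proof safe
  fix f :: "nat \<Rightarrow> real"
  assume f: "strict_mono f" and r: "range f \<subseteq> {x + y |x y. x \<in> A \<and> y \<in> B}"
  have "\<forall>k. \<exists>x y. f k = x + y \<and> x \<in> A \<and> y \<in> B" using r by blast
  then obtain x y where xy: "\<And>k. f k = x k + y k" "\<And>k. x k \<in> A" "\<And>k. y k \<in> B" by metis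
  obtain s :: "nat \<Rightarrow> nat" where s: "strict_mono s" "monoseq (\<lambda>n. x (s n))"
    using seq_monosub[of x] by blast
  have fs: "f (s i) < f (s j)" if "i < j" for i j
    using that f s(1) by (simp add: strict_mono_def)
  from s(2) consider "incseq (\<lambda>n. x (s n))" | "decseq (\<lambda>n. x (s n))"
    by (auto simp: monoseq_iff)
  then show False
  proof cases
    case 2
    have "strict_mono (\<lambda>n. y (s n))"
    proof (rule strict_monoI)
      fix i j :: nat assume "i < j"
      with fs[OF this] decseqD[OF 2, of i j] show "y (s i) < y (s j)" by (simp add: xy(1))
    qed
    with B xy(3) show False unfolding no_inc_def by blast
  next
    case 1
    have "\<exists>m\<in>range (\<lambda>n. x (s n)). \<forall>z\<in>range (\<lambda>n. x (s n)). z \<le> m"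
      by (rule no_inc_max[OF A]) (use xy in auto)
    then obtain K where K: "\<And>n. x (s n) \<le> x (s K)" by auto
    have "strict_mono (\<lambda>n. y (s (K + n)))"
    proof (rule strict_monoI)
      fix i j :: nat assume "i < j"
      then have "f (s (K + i)) < f (s (K + j))" by (intro fs) simp
      moreover have "x (s K) \<le> x (s (K + i))" by (rule incseqD[OF 1]) simp
      ultimately show "y (s (K + i)) < y (s (K + j))" using K[of "K + j"] by (simp add: xy(1))
    qed
    with B xy(3) show False unfolding no_inc_def by blast
  qed
qed

lemma no_inc_unit_fractions: "no_inc {1 / real k |k. 1 \<le> k}"
  unfolding no_inc_def
proof safe
  fix f :: "nat \<Rightarrow> real"
  assume f: "strict_mono f" and r: "range f \<subseteq> {1 / real k |k. 1 \<le> k}"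
  have "\<forall>i. \<exists>k. f i = 1 / real k \<and> 1 \<le> k" using r by blast
  then obtain k where k: "\<And>i. f i = 1 / real (k i)" "\<And>i. 1 \<le> k i" by metis
  have le: "k i \<le> k 0" for i
  proof -
    have "f 0 \<le> f i" using f by (simp add: strict_mono_less_eq)
    then show ?thesis using k(2)[of i] k(2)[of 0] by (simp add: k(1) field_simps)
  qed
  have "inj k"
  proof (rule injI)
    fix i j assume "k i = k j"
    then have "f i = f j" by (simp add: k(1))
    then show "i = j" using f by (simp add: strict_mono_eq)
  qed
  moreover have "range k \<subseteq> {..k 0}" using le by auto
  then have "finite (range k)" by (rule finite_subset) simp
  ultimately show False using finite_imageD[of k UNIV] by simp
qed

lemma no_inc_usum: "no_inc {usum a n |a. \<forall>i\<in>{1..n}. 1 \<le> a i}"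
proof (induction n)
  case 0
  show ?case unfolding no_inc_def usum_def
  proof safe
    fix f :: "nat \<Rightarrow> real"
    assume f: "strict_mono f"
      and r: "range f \<subseteq> {\<Sum>i=1..0. 1 / real (a i) |a :: nat \<Rightarrow> nat. \<forall>i\<in>{1..0}. 1 \<le> a i}"
    have "f i = 0" for i
      using subsetD[OF r rangeI[of f i]] by auto
    moreover have "f 0 < f 1" using f by (simp add: strict_mono_def)
    ultimately show False by simp
  qed
next
  case (Suc n)
  have "{usum a (Suc n) |a. \<forall>i\<in>{1..Suc n}. 1 \<le> a i} \<subseteq>
      {x + y |x y. x \<in> {usum a n |a. \<forall>i\<in>{1..n}. 1 \<le> a i} \<and> y \<in> {1 / real k |k. 1 \<le> k}}"
    by (fastforce simp: usum_def)
  with no_inc_plus[OF Suc no_inc_unit_fractions] show ?case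
    by (rule no_inc_subset)
qed

lemma best_under_max:
  assumes "0 < lam"
  shows "\<exists>a\<in>denom_tuples n. usum a n < lam \<and> usum a n = best_under n lam"
    and "a \<in> denom_tuples n \<Longrightarrow> usum a n < lam \<Longrightarrow> usum a n \<le> best_under n lam"
proof -
  define S where "S = {usum a n |a. a \<in> denom_tuples n \<and> usum a n < lam}"
  obtain k :: nat where k: "real n / lam < real k" using reals_Archimedean2 by blast
  have "usum (\<lambda>_. k + 2) n = real n / real (k + 2)" by (simp add: usum_def)
  also have "\<dots> < lam"
  proof -
    have "real n < real k * lam" using k assms by (simp add: field_simps)
    also have "\<dots> < real (k + 2) * lam" using assms by (simp add: distrib_right)
    finally show ?thesis by (simp add: field_simps)
  qed
  finally have "usum (\<lambda>_. k + 2) n < lam" .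
  moreover have "(\<lambda>_. k + 2) \<in> denom_tuples n" by (simp add: denom_tuples_def)
  ultimately have "S \<noteq> {}" unfolding S_def by blast
  moreover have "S \<subseteq> {usum a n |a. \<forall>i\<in>{1..n}. 1 \<le> a i}"
    unfolding S_def denom_tuples_def by force
  ultimately obtain m where m: "m \<in> S" "\<And>x. x \<in> S \<Longrightarrow> x \<le> m"
    using no_inc_max[OF no_inc_usum] by meson
  have "best_under n lam = m"
    unfolding best_under_def by (rule Greatest_equality) (use m in \<open>auto simp: S_def\<close>)
  with m show "\<exists>a\<in>denom_tuples n. usum a n < lam \<and> usum a n = best_under n lam"
    and "a \<in> denom_tuples n \<Longrightarrow> usum a n < lam \<Longrightarrow> usum a n \<le> best_under n lam"
    unfolding S_def by force+
qed

lemma greedy_tail_ge: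
  assumes "2 \<le> t"
  shows "j + 2 \<le> greedy_tail t j"
proof (induction j)
  case (Suc j)
  have "greedy_tail t j * 2 \<le> greedy_tail t j * (greedy_tail t j + 1)"
    using Suc by (intro mult_le_mono2) simp
  then have "greedy_tail t j * 2 \<le> greedy_tail t (Suc j)" by simp
  with Suc show ?case by linarith
qed (use assms in simp)

lemma eventually_greedy_best_sums:
  assumes "eventually_greedy_best lam b"
  shows "(\<lambda>n. 1 / real (b (Suc n))) sums lam"
proof -
  from assms obtain N T0 where T0: "2 \<le> T0" and lam: "lam = usum b N + 1 / real T0"
    and b: "\<And>j. b (N + j + 1) = greedy_tail T0 j + 1"
    unfolding eventually_greedy_best_def by blast
  let ?T = "\<lambda>j. real (greedy_tail T0 j)"
  have ge: "real j + 2 \<le> ?T j" for j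
    using greedy_tail_ge[OF T0, of j] by linarith
  have "(\<lambda>j. 1 / ?T j) \<longlonglongrightarrow> 0"
  proof (rule tendsto_sandwich[where f = "\<lambda>_. 0" and h = "\<lambda>j. 1 / real (Suc j)"])
    show "(\<lambda>j. 1 / real (Suc j)) \<longlonglongrightarrow> 0"
      using LIMSEQ_inverse_real_of_nat by (simp add: inverse_eq_divide)
    have "1 / ?T j \<le> 1 / real (Suc j)" for j
      by (rule frac_le) (use ge[of j] in auto)
    then show "\<forall>\<^sub>F j in sequentially. 1 / ?T j \<le> 1 / real (Suc j)"
      by (intro always_eventually allI)
  qed auto
  from telescope_sums'[OF this]
  have "(\<lambda>j. 1 / ?T j - 1 / ?T (Suc j)) sums (1 / ?T 0 - 0)" .
  moreover have "1 / ?T j - 1 / ?T (Suc j) = 1 / real (b (Suc (j + N)))" for j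
  proof -
    have *: "1 / t - 1 / (t * (t + 1)) = 1 / (t + 1)" if "0 < t" for t :: real
      using that by (simp add: divide_simps)
    have "0 < ?T j" using ge[of j] by linarith
    from *[OF this] b[of j] show ?thesis by (simp add: algebra_simps)
  qed
  ultimately have "(\<lambda>j. 1 / real (b (Suc (j + N)))) sums (1 / real T0)" by simp
  then have "(\<lambda>n. 1 / real (b (Suc n))) sums (1 / real T0 + (\<Sum>i<N. 1 / real (b (Suc i))))"
    by (subst (asm) sums_iff_shift)
  moreover have "(\<Sum>i<N. 1 / real (b (Suc i))) = usum b N"
    by (simp add: usum_def sum.atLeast1_atMost_eq)
  ultimately show ?thesis by (simp add: lam add.commute)
qed

lemma eventually_greedy_best_limit:
  assumes "eventually_greedy_best lam b"
  shows "\<exists>L>0. (\<lambda>n. real (b n) powr (1 / 2 ^ n)) \<longlonglongrightarrow> L"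
proof -
  from assms obtain N T0 where T0: "2 \<le> T0"
    and b: "\<And>j. b (N + j + 1) = greedy_tail T0 j + 1"
    unfolding eventually_greedy_best_def by blast
  let ?T = "\<lambda>j. real (greedy_tail T0 j)"
  define g where "g j = ln (?T j + 1) / 2 ^ j" for j
  have ge: "real j + 2 \<le> ?T j" for j
    using greedy_tail_ge[OF T0, of j] by linarith
  have "g (Suc j) \<le> g j" for j
  proof -
    have "?T (Suc j) + 1 \<le> (?T j + 1)\<^sup>2" by (simp add: power2_eq_square algebra_simps)
    then have "ln (?T (Suc j) + 1) \<le> ln ((?T j + 1)\<^sup>2)"
      using ge[of "Suc j"] ge[of j] by (intro ln_mono) auto
    also have "\<dots> = 2 * ln (?T j + 1)" using ge[of j] by (simp add: ln_realpow)
    finally show ?thesis by (simp add: g_def field_simps del: greedy_tail.simps)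
  qed
  then have "decseq g" by (simp add: decseq_Suc_iff)
  moreover have "0 \<le> g j" for j using ge[of j] by (simp add: g_def)
  ultimately obtain l where "g \<longlonglongrightarrow> l" using decseq_convergent[of g 0] by blast
  then have "(\<lambda>j. exp (g j / 2 ^ (N + 1))) \<longlonglongrightarrow> exp (l / 2 ^ (N + 1))"
    by (intro tendsto_intros) auto
  moreover have "exp (g j / 2 ^ (N + 1)) = real (b (j + (N + 1))) powr (1 / 2 ^ (j + (N + 1)))" for j
    using b[of j] ge[of j] by (simp add: g_def powr_def power_add ac_simps)
  ultimately have "(\<lambda>j. real (b (j + (N + 1))) powr (1 / 2 ^ (j + (N + 1)))) \<longlonglongrightarrow> exp (l / 2 ^ (N + 1))"
    by simp
  then have "(\<lambda>n. real (b n) powr (1 / 2 ^ n)) \<longlonglongrightarrow> exp (l / 2 ^ (N + 1))"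
    by (rule LIMSEQ_offset)
  then show ?thesis by (intro exI[of _ "exp (l / 2 ^ (N + 1))"]) simp
qed

end

theory Submission
  imports Defs
begin

text \<open>
  Let \<open>x n = 1 / (lam - usum a n)\<close>, let \<open>1 / t n\<close> be the corresponding remainder of \<open>b\<close>, and let
  \<open>L\<close> be the limit of \<open>b n powr (1 / 2 ^ n)\<close>. Optimality of \<open>b\<close> gives \<open>x n \<le> t n \<le> L ^ 2 ^ (n + 1)\<close>.
  As \<open>lam\<close> is rational with denominator \<open>d\<close>, the number \<open>P n = d * a 1 * \<dots> * a n / x n\<close> is a
  positive integer. Suppose the limit inferior for \<open>a\<close> is at least \<open>L\<close>. Then \<open>x n\<close> is also nearly
  as large as \<open>L ^ 2 ^ (n + 1)\<close>, so \<open>a (n + 1)\<close> is extremely close to \<open>x n\<close> in ratio, and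
  \<open>Q n = P n * x n\<close> satisfies \<open>Q (n + 1) \<approx> (Q n)\<^sup>2 / P n\<close>. If \<open>P n\<close> is minimal among the later
  numerators, any later increase of \<open>P\<close> would cost \<open>Q\<close> a factor that the growth rate \<open>L\<close> does
  not allow. Hence \<open>P\<close> is eventually constant, which forces \<open>a (n + 1) = x n + 1\<close> and
  \<open>x (n + 1) = x n * (x n + 1)\<close>. If then \<open>x n < t n\<close> for some such \<open>n\<close>, the integer
  \<open>a (n + 1)\<close> is at most \<open>t n\<close>, and \<open>a\<close> grows strictly slower than \<open>b\<close>.
\<close>

section \<open>Doubling recursions and eventual constancy of integer numerators\<close>

lemma eventually_const_less_double_exp:
  fixes c l :: real
  assumes "0 < l"
  shows "\<forall>\<^sub>F n in sequentially. c < l * 2 ^ n"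
proof -
  obtain k :: nat where k: "c / l < 2 ^ k"
    using real_arch_pow[of 2 "c / l"] by auto
  have "c < l * 2 ^ n" if "k \<le> n" for n
  proof -
    have "(2::real) ^ k \<le> 2 ^ n" using that by (intro power_increasing) auto
    with k have "c / l < 2 ^ n" by linarith
    then show ?thesis using assms by (simp add: field_simps)
  qed
  then show ?thesis unfolding eventually_sequentially by blast
qed

lemma suffix_minimum:
  fixes f :: "nat \<Rightarrow> nat"
  obtains g where "k \<le> g" "\<And>j. k \<le> j \<Longrightarrow> f g \<le> f j"
proof -
  define S where "S = f ` {k..}"
  have "S \<noteq> {}" by (auto simp: S_def)
  then have "(LEAST v. v \<in> S) \<in> S" by (metis LeastI_ex ex_in_conv)
  then obtain g where g: "k \<le> g" "f g = (LEAST v. v \<in> S)" unfolding S_def by auto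
  have "f g \<le> f j" if "k \<le> j" for j
    unfolding g(2) by (rule Least_le) (use that in \<open>auto simp: S_def\<close>)
  with g(1) that show thesis by blast
qed

text \<open>If \<open>ln (P k)\<close> exceeded \<open>e * 2 ^ k\<close> for all
  \<open>k \<ge> K\<close>, the normalized quantity \<open>v\<close> would drop by at least
  \<open>e / 4\<close> at every late step, although it is nonnegative. The index found makes
  \<open>P\<close> small enough for a unit increase to outweigh the error in the recursion.\<close>

lemma subexponential_numerator:
  fixes P :: "nat \<Rightarrow> nat" and y :: "nat \<Rightarrow> real" and e C :: real
  assumes pos: "\<And>n. 0 < P n"
    and step: "\<And>n. K \<le> n \<Longrightarrow>
      ln (real (P (Suc n))) + y (Suc n) \<le> ln (real (P n)) + 2 * y n + C"
    and y0: "\<And>n. K \<le> n \<Longrightarrow> 0 \<le> y n"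
    and "0 < e"
  shows "\<exists>k\<ge>K. ln (real (P k)) \<le> e * 2 ^ k"
proof (rule ccontr)
  assume "\<not> ?thesis"
  then have big: "e * 2 ^ k < ln (real (P k))" if "K \<le> k" for k using that by force
  define v where "v k = (ln (real (P k)) + y k) / 2 ^ k" for k
  \<comment> \<open>Once this holds, \<open>C\<close> uses up at most half of the loss
    \<open>e * 2 ^ k\<close>; dividing the other half by \<open>2 ^ Suc k\<close> leaves
    \<open>e / 4\<close>.\<close>
  have ev: "\<forall>\<^sub>F n in sequentially. 2 * C < e * 2 ^ n"
    by (rule eventually_const_less_double_exp) fact
  then obtain M where M: "\<And>n. M \<le> n \<Longrightarrow> 2 * C < e * 2 ^ n"
    by (auto simp: eventually_sequentially)
  define k0 where "k0 = max M K"
  have vs: "v (Suc k) \<le> v k - e / 4" if "k0 \<le> k" for k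
  proof -
    have "K \<le> k" "M \<le> k" using that by (auto simp: k0_def)
    then have "ln (real (P (Suc k))) + y (Suc k)
        \<le> 2 * (ln (real (P k)) + y k) - e * 2 ^ k / 2"
      using step[OF \<open>K \<le> k\<close>] big[OF \<open>K \<le> k\<close>] M[OF \<open>M \<le> k\<close>] by argo
    then have "v (Suc k) \<le> (2 * (ln (real (P k)) + y k) - e * 2 ^ k / 2) / 2 ^ Suc k"
      unfolding v_def by (intro divide_right_mono) auto
    also have "\<dots> = v k - e / 4" by (simp add: v_def field_simps)
    finally show ?thesis .
  qed
  have vi: "v (k0 + i) \<le> v k0 - real i * (e / 4)" for i
  proof (induction i)
    case (Suc i)
    then show ?case using vs[of "k0 + i"] by (simp add: distrib_right add_divide_distrib)
  qed simp
  obtain i :: nat where "v k0 / (e / 4) < real i" using reals_Archimedean2 by blast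
  then have "v k0 < real i * (e / 4)" using \<open>0 < e\<close> by (simp add: field_simps)
  then have "v (k0 + i) < 0" using vi[of i] by linarith
  moreover have "0 \<le> v (k0 + i)"
  proof -
    have "1 \<le> real (P (k0 + i))" using pos[of "k0 + i"] by linarith
    then have "0 \<le> ln (real (P (k0 + i)))" by (rule ln_ge_zero)
    moreover have "0 \<le> y (k0 + i)" by (rule y0) (simp add: k0_def)
    ultimately show ?thesis by (simp add: v_def)
  qed
  ultimately show False by linarith
qed

text \<open>From \<open>n\<close> on, the auxiliary quantity \<open>u\<close> at most doubles at
  each step, because its summand \<open>D\<close> absorbs the additive error. A jump of
  \<open>P\<close> at \<open>Suc n\<close> makes the next doubling lose
  \<open>ln (1 + 1 / P n)\<close>, and this loss is itself doubled forever after. The lower bound on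
  \<open>y\<close> leaves no room for such a deficit.\<close>

lemma minimal_numerator_persists:
  fixes P :: "nat \<Rightarrow> nat" and y :: "nat \<Rightarrow> real" and l D :: real
  assumes pos: "0 < P n"
    and step: "\<And>k. n \<le> k \<Longrightarrow>
      ln (real (P (Suc k))) + y (Suc k) \<le> ln (real (P k)) + 2 * y k + D"
    and upper: "y n \<le> l * 2 ^ Suc n"
    and lower: "\<And>e. 0 < e \<Longrightarrow> \<forall>\<^sub>F k in sequentially. (l - e) * 2 ^ Suc k \<le> y k"
    and min: "\<And>k. n \<le> k \<Longrightarrow> P n \<le> P k"
    and D: "0 \<le> D" "4 * D < ln (1 + 1 / real (P n))"
  shows "P (Suc n) = P n"
proof (rule ccontr)
  assume "P (Suc n) \<noteq> P n"
  with min[of "Suc n"] have up: "P n + 1 \<le> P (Suc n)" by simp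
  define m where "m = ln (real (P n))"
  define u where "u k = ln (real (P k)) + y k - m + D" for k
  \<comment> \<open>The term \<open>4 * D\<close> is the surplus \<open>D\<close> of
    \<open>u n\<close> after the two doublings from \<open>n\<close> to
    \<open>n + 2\<close>.\<close>
  define \<kappa> where "\<kappa> = ln (1 + 1 / real (P n)) - 4 * D"
  have "0 < \<kappa>" using D by (simp add: \<kappa>_def)
  have mle: "m \<le> ln (real (P k))" if "n \<le> k" for k
    unfolding m_def using min[OF that] pos by (intro ln_mono) auto
  have us: "u (Suc k) \<le> 2 * u k + m - ln (real (P k))" if "n \<le> k" for k
    using step[OF that] by (simp add: u_def)
  have "m + ln (1 + 1 / real (P n)) = ln (real (P n) * (1 + 1 / real (P n)))"
    unfolding m_def using pos by (subst ln_mult_pos) (auto intro: add_pos_nonneg)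
  also have "\<dots> = ln (real (P n + 1))" using pos by (simp add: distrib_left add.commute)
  also have "\<dots> \<le> ln (real (P (Suc n)))" using up by (intro ln_mono) auto
  finally have gain: "m + ln (1 + 1 / real (P n)) \<le> ln (real (P (Suc n)))" .
  have "u n \<le> l * 2 ^ Suc n + D" using upper by (simp add: u_def m_def)
  moreover have "u (Suc n) \<le> 2 * u n" using us[of n] by (simp add: m_def)
  moreover have "u (Suc (Suc n)) \<le> 2 * u (Suc n) - ln (1 + 1 / real (P n))"
    using us[of "Suc n"] gain by simp
  ultimately have base: "u (n + 2) \<le> l * 2 ^ (n + 3) - \<kappa>"
    by (simp add: \<kappa>_def power_add)
  have ui: "u (n + 2 + i) \<le> 2 ^ i * (l * 2 ^ (n + 3) - \<kappa>)" for i
  proof (induction i)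
    case (Suc i)
    have "u (Suc (n + 2 + i)) \<le> 2 * u (n + 2 + i)"
      using us[of "n + 2 + i"] mle[of "n + 2 + i"] by simp
    with Suc show ?case by simp
  qed (use base in simp)
  \<comment> \<open>With this choice \<open>e * 2 ^ (n + 3)\<close> is \<open>\<kappa> / 2\<close>,
    so the lower bound permits only half of the deficit accumulated at \<open>n + 2\<close>; both
    sides scale by the same power of 2 afterwards.\<close>
  define e where "e = \<kappa> / 2 ^ (n + 4)"
  have "0 < e" using \<open>0 < \<kappa>\<close> by (simp add: e_def)
  from lower[OF this] obtain k0 where k0: "\<And>k. k0 \<le> k \<Longrightarrow> (l - e) * 2 ^ Suc k \<le> y k"
    by (auto simp: eventually_sequentially)
  have "(l - e) * 2 ^ Suc (n + 2 + k0) \<le> y (n + 2 + k0)" by (rule k0) simp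
  also have "\<dots> \<le> u (n + 2 + k0)" using mle[of "n + 2 + k0"] D(1) by (simp add: u_def)
  also have "\<dots> \<le> 2 ^ k0 * (l * 2 ^ (n + 3) - \<kappa>)" by (rule ui)
  finally have "2 ^ k0 * (l * 2 ^ (n + 3) - e * 2 ^ (n + 3)) \<le> 2 ^ k0 * (l * 2 ^ (n + 3) - \<kappa>)"
    by (simp add: power_add algebra_simps)
  then have "\<kappa> \<le> e * 2 ^ (n + 3)" by simp
  also have "\<dots> = \<kappa> / 2" by (simp add: e_def power_add)
  finally show False using \<open>0 < \<kappa>\<close> by simp
qed

text \<open>A minimum of \<open>P\<close> beyond an index where \<open>P\<close> is small is itself
  small, so the error \<open>2 * exp (- (l * 2 ^ n))\<close> cannot pay for a unit increase. Hence
  the minimum is passed on from each index to the next.\<close>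

lemma eventually_constant_numerator:
  fixes P :: "nat \<Rightarrow> nat" and y :: "nat \<Rightarrow> real" and l :: real
  assumes "0 < l"
    and pos: "\<And>n. 0 < P n"
    and step: "\<forall>\<^sub>F n in sequentially.
      ln (real (P (Suc n))) + y (Suc n) \<le> ln (real (P n)) + 2 * y n + 2 * exp (- (l * 2 ^ n))"
    and upper: "\<forall>\<^sub>F n in sequentially. y n \<le> l * 2 ^ Suc n"
    and lower: "\<And>e. 0 < e \<Longrightarrow> \<forall>\<^sub>F n in sequentially. (l - e) * 2 ^ Suc n \<le> y n"
  shows "\<exists>m. \<forall>\<^sub>F n in sequentially. P n = m"
proof -
  have "\<forall>\<^sub>F n in sequentially. (l - l / 2) * 2 ^ Suc n \<le> y n"
    using \<open>0 < l\<close> by (intro lower) simp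
  \<comment> \<open>This gives \<open>E < 1 / 17\<close> below, which is small enough for
    \<open>8 * (E * E) < E - E * E\<close>.\<close>
  moreover have "\<forall>\<^sub>F n in sequentially. ln 17 < (l / 2) * 2 ^ n"
    by (rule eventually_const_less_double_exp) (use \<open>0 < l\<close> in simp)
  ultimately have "\<forall>\<^sub>F n in sequentially.
      ln (real (P (Suc n))) + y (Suc n) \<le> ln (real (P n)) + 2 * y n + 2 * exp (- (l * 2 ^ n))
      \<and> y n \<le> l * 2 ^ Suc n \<and> (l - l / 2) * 2 ^ Suc n \<le> y n \<and> ln 17 < (l / 2) * 2 ^ n"
    using step upper by eventually_elim blast
  then obtain K where
    K: "\<And>n. K \<le> n \<Longrightarrow> ln (real (P (Suc n))) + y (Suc n)
        \<le> ln (real (P n)) + 2 * y n + 2 * exp (- (l * 2 ^ n))"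
      "\<And>n. K \<le> n \<Longrightarrow> y n \<le> l * 2 ^ Suc n"
      "\<And>n. K \<le> n \<Longrightarrow> (l - l / 2) * 2 ^ Suc n \<le> y n"
      "\<And>n. K \<le> n \<Longrightarrow> ln 17 < (l / 2) * 2 ^ n"
    unfolding eventually_sequentially by blast
  have "\<exists>k\<ge>K. ln (real (P k)) \<le> (l / 2) * 2 ^ k"
  proof (rule subexponential_numerator[OF pos])
    fix n assume "K \<le> n"
    have "exp (- (l * 2 ^ n)) \<le> 1" using \<open>0 < l\<close> by simp
    then show "ln (real (P (Suc n))) + y (Suc n) \<le> ln (real (P n)) + 2 * y n + 2"
      using K(1)[OF \<open>K \<le> n\<close>] by linarith
    have "0 \<le> (l - l / 2) * 2 ^ Suc n" using \<open>0 < l\<close> by simp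
    then show "0 \<le> y n" using K(3)[OF \<open>K \<le> n\<close>] by linarith
  qed (use \<open>0 < l\<close> in simp)
  then obtain k where k: "K \<le> k" "ln (real (P k)) \<le> (l / 2) * 2 ^ k" by blast
  obtain g where g: "k \<le> g" "\<And>j. k \<le> j \<Longrightarrow> P g \<le> P j" using suffix_minimum by blast
  have "P (g + i) = P g" for i
  proof (induction i)
    case (Suc i)
    let ?n = "g + i"
    have n: "K \<le> ?n" using k(1) g(1) by simp
    \<comment> \<open>\<open>E\<close> is the square root of the exponential in the error term, and
      \<open>P g \<le> 1 / E\<close>. So an error of order \<open>E * E\<close> competes with a gain
      of at least \<open>ln (1 + E)\<close>.\<close>
    define E where "E = exp (- ((l / 2) * 2 ^ ?n))"
    have "exp (ln 17) < exp ((l / 2) * 2 ^ ?n)" using K(4)[OF n] by (subst exp_less_cancel_iff)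
    then have E: "0 < E" "E < 1 / 17" by (auto simp: E_def exp_minus field_simps)
    have "exp (- (l * 2 ^ ?n)) = E * E" by (simp add: E_def flip: exp_add)
    then have step': "ln (real (P (Suc j))) + y (Suc j) \<le> ln (real (P j)) + 2 * y j + 2 * (E * E)"
      if "?n \<le> j" for j
    proof -
      have "(2::real) ^ ?n \<le> 2 ^ j" using that by (intro power_increasing) auto
      then have "exp (- (l * 2 ^ j)) \<le> exp (- (l * 2 ^ ?n))" using \<open>0 < l\<close> by simp
      also have "\<dots> = E * E" by fact
      finally show ?thesis using K(1)[of j] n that by linarith
    qed
    have "ln (real (P g)) \<le> ln (real (P k))"
      using g(2)[of k] pos[of g] by (intro ln_mono) auto
    also have "\<dots> \<le> (l / 2) * 2 ^ k" by fact
    also have "\<dots> \<le> (l / 2) * 2 ^ ?n"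
      using g(1) \<open>0 < l\<close> by (intro mult_left_mono power_increasing) auto
    finally have "exp (ln (real (P g))) \<le> exp ((l / 2) * 2 ^ ?n)" by (subst exp_le_cancel_iff)
    then have EP: "E \<le> 1 / real (P g)"
      using pos[of g] by (simp add: E_def exp_minus field_simps)
    have "4 * (2 * (E * E)) < E - E\<^sup>2" using E by (simp add: power2_eq_square field_simps)
    also have "\<dots> \<le> ln (1 + E)" using E by (intro ln_one_plus_pos_lower_bound) auto
    also have "\<dots> \<le> ln (1 + 1 / real (P g))" using E EP by (intro ln_mono) auto
    finally have small: "4 * (2 * (E * E)) < ln (1 + 1 / real (P g))" .
    have "P (Suc ?n) = P ?n"
    proof (rule minimal_numerator_persists[where y = y and l = l and D = "2 * (E * E)"])
      show "P ?n \<le> P j" if "?n \<le> j" for j using g(1) g(2)[of j] that Suc by simp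
      show "4 * (2 * (E * E)) < ln (1 + 1 / real (P ?n))" using small Suc by simp
    qed (use pos step' K(2)[OF n] lower in auto)
    with Suc show ?case by simp
  qed simp
  then have "\<forall>n\<ge>g. P n = P g" by (metis le_add_diff_inverse)
  then show ?thesis unfolding eventually_sequentially by blast
qed

section \<open>Remainders and limits on the doubly exponential scale\<close>

text \<open>The bound \<open>h\<close> decreases by at least \<open>1 / a (Suc n)\<close> at each
  late step, while \<open>r\<close> decreases by exactly that. So \<open>r - h\<close> never
  decreases, and it lies below a sequence tending to 0.\<close>

lemma double_exp_tail_bound:
  fixes r a :: "nat \<Rightarrow> real" and \<beta> :: real
  assumes "0 < \<beta>"
    and rec: "\<And>n. r n = r (Suc n) + 1 / a (Suc n)"
    and lim: "r \<longlonglongrightarrow> 0"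
    and big: "\<forall>\<^sub>F n in sequentially. exp (\<beta> * 2 ^ n) \<le> a n"
  shows "\<forall>\<^sub>F n in sequentially. r n \<le> 2 * exp (- (\<beta> * 2 ^ Suc n))"
proof -
  have "\<forall>\<^sub>F n in sequentially. ln 2 < \<beta> * 2 ^ n"
    by (rule eventually_const_less_double_exp) fact
  with big have "\<forall>\<^sub>F n in sequentially. exp (\<beta> * 2 ^ n) \<le> a n \<and> ln 2 < \<beta> * 2 ^ n"
    by eventually_elim blast
  then obtain K where K: "\<And>n. K \<le> n \<Longrightarrow> exp (\<beta> * 2 ^ n) \<le> a n"
      "\<And>n. K \<le> n \<Longrightarrow> ln 2 < \<beta> * 2 ^ n"
    unfolding eventually_sequentially by blast
  define h where "h n = 2 * exp (- (\<beta> * 2 ^ Suc n))" for n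
  have hs: "h (Suc n) + 1 / a (Suc n) \<le> h n" if "K \<le> n" for n
  proof -
    define z where "z = \<beta> * 2 ^ Suc n"
    have "exp (ln 2) < exp z" unfolding exp_less_cancel_iff z_def using K(2)[of "Suc n"] that by simp
    then have z: "2 < exp z" by simp
    have "1 / a (Suc n) \<le> 1 / exp z"
      using K(1)[of "Suc n"] that unfolding z_def by (intro frac_le) auto
    moreover have "h (Suc n) = 2 / (exp z * exp z)"
      by (simp add: h_def z_def exp_minus field_simps flip: exp_add)
    moreover have "2 / (exp z * exp z) \<le> 1 / exp z" using z by (simp add: field_simps)
    moreover have "h n = 2 / exp z" by (simp add: h_def z_def exp_minus field_simps)
    ultimately show ?thesis by simp
  qed
  have "r n \<le> h n" if n: "K \<le> n" for n
  proof -
    have mono: "r n - h n \<le> r (n + i) - h (n + i)" for i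
    proof (induction i)
      case (Suc i)
      then show ?case using hs[of "n + i"] rec[of "n + i"] n by simp
    qed simp
    have "r n - h n \<le> r (n + i)" for i using mono[of i] by (simp add: h_def add_increasing2 order_trans)
    moreover have "(\<lambda>i. r (n + i)) \<longlonglongrightarrow> 0"
      using LIMSEQ_ignore_initial_segment[OF lim, of n] by (simp add: add.commute)
    ultimately have "r n - h n \<le> 0" by (intro LIMSEQ_le_const) auto
    then show ?thesis by simp
  qed
  then show ?thesis unfolding eventually_sequentially h_def by blast
qed

text \<open>Since \<open>greedy_tail T0 (Suc j)\<close> exceeds the square of its predecessor, the
  normalized logarithms \<open>f\<close> increase strictly; they stay below those of
  \<open>b\<close>, which tend to \<open>ln L\<close>. The strictness later separates a sequence
  that has fallen behind from \<open>b\<close>.\<close>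

lemma greedy_tail_less_limit:
  assumes T0: "2 \<le> T0" and b: "\<And>j. b (N + j + 1) = greedy_tail T0 j + 1"
    and "0 < L" and lim: "(\<lambda>n. real (b n) powr (1 / 2 ^ n)) \<longlonglongrightarrow> L"
  shows "ln (real (greedy_tail T0 j)) < ln L * 2 ^ (N + j + 1)"
proof -
  define f where "f j = ln (real (greedy_tail T0 j)) / 2 ^ (N + j + 1)" for j
  define g where "g n = ln (real (b n)) / 2 ^ n" for n
  have pos: "2 \<le> real (greedy_tail T0 j)" for j using greedy_tail_ge[OF T0, of j] by linarith
  have inc: "f j < f (Suc j)" for j
  proof -
    let ?t = "real (greedy_tail T0 j)"
    have "2 * ln ?t = ln (?t * ?t)" using pos[of j] by (simp add: ln_mult)
    also have "\<dots> < ln (?t * (?t + 1))" using pos[of j] by (subst ln_less_cancel_iff) auto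
    also have "\<dots> = ln (real (greedy_tail T0 (Suc j)))" by (simp add: algebra_simps)
    finally show ?thesis by (simp add: f_def field_simps del: greedy_tail.simps)
  qed
  have "(\<lambda>n. ln (real (b n) powr (1 / 2 ^ n))) \<longlonglongrightarrow> ln L"
    using lim \<open>0 < L\<close> by (intro tendsto_ln) auto
  moreover have "ln (real (b (N + j + 1)) powr (1 / 2 ^ (N + j + 1))) = g (N + j + 1)" for j
    using b[of j] by (simp add: g_def ln_powr)
  ultimately have gl: "(\<lambda>j. g (N + j + 1)) \<longlonglongrightarrow> ln L"
    using LIMSEQ_ignore_initial_segment[of "\<lambda>n. ln (real (b n) powr (1 / 2 ^ n))" "ln L" "N + 1"]
    by (simp add: ac_simps)
  have fg: "f j \<le> g (N + j + 1)" for j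
    unfolding f_def g_def b using pos[of j] by (intro divide_right_mono ln_mono) auto
  have "incseq f" using inc by (intro incseq_SucI less_imp_le)
  then have "f (Suc j) \<le> f i" if "Suc j \<le> i" for i using that by (rule incseqD)
  then have "\<forall>i\<ge>Suc j. f (Suc j) \<le> g (N + i + 1)" using fg order_trans by blast
  \<comment> \<open>The limit yields only a weak inequality, so it is applied at
    \<open>Suc j\<close>; the step from \<open>j\<close> to \<open>Suc j\<close> restores
    strictness.\<close>
  with gl have "f (Suc j) \<le> ln L" by (intro LIMSEQ_le_const) auto
  with inc[of j] have "f j < ln L" by simp
  then show ?thesis by (simp add: f_def field_simps)
qed

lemma prod_mult_usum_Ints:
  assumes "\<And>i. i \<in> {1..n} \<Longrightarrow> 0 < a i"
  shows "real (\<Prod>i=1..n. a i) * usum a n \<in> \<int>"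
  using assms
proof (induction n)
  case (Suc n)
  have "real (\<Prod>i=1..Suc n. a i) * usum a (Suc n)
      = real (a (Suc n)) * (real (\<Prod>i=1..n. a i) * usum a n) + real (\<Prod>i=1..n. a i)"
    using Suc.prems[of "Suc n"] by (simp add: usum_def algebra_simps)
  then show ?case using Suc by (auto intro!: Ints_add Ints_mult)
qed (simp add: usum_def)

lemma liminf_lower_bound:
  fixes a :: "nat \<Rightarrow> nat"
  assumes "0 < L" and "ereal L \<le> liminf (\<lambda>n. ereal (real (a n) powr (1 / 2 ^ n)))"
    and "0 < e"
  shows "\<forall>\<^sub>F n in sequentially. exp ((ln L - e) * 2 ^ n) \<le> real (a n)"
proof -
  have "exp (ln L - e) < L" using assms by (simp add: exp_diff divide_less_eq)
  then have "\<forall>\<^sub>F n in sequentially. ereal (exp (ln L - e)) < ereal (real (a n) powr (1 / 2 ^ n))"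
    using assms(2) unfolding le_Liminf_iff by (metis less_ereal.simps(1))
  then show ?thesis
  proof eventually_elim
    case (elim n)
    then have lt: "exp (ln L - e) < real (a n) powr (1 / 2 ^ n)" by simp
    \<comment> \<open>Here \<open>a n\<close> might be 0, but \<open>0 powr s\<close> is 0, which
      the strict positive lower bound excludes.\<close>
    then have "real (a n) powr (1 / 2 ^ n) \<noteq> 0" using exp_gt_zero[of "ln L - e"] by linarith
    then have "0 < real (a n)" by simp
    have "exp (ln L - e) powr 2 ^ n \<le> (real (a n) powr (1 / 2 ^ n)) powr 2 ^ n"
      using lt by (intro powr_mono2) auto
    with \<open>0 < real (a n)\<close> show ?case by (simp add: powr_powr powr_def mult.commute)
  qed
qed

section \<open>Rigidity at the growth rate of the greedy sequence\<close>

theorem theorem4: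
  fixes lam :: real and a b :: "nat \<Rightarrow> nat"
  assumes "lam \<in> \<rat>" and "0 < lam"
    and "eventually_greedy_best lam b"
    and "2 \<le> a 1" and "\<forall>n\<ge>1. a n \<le> a (Suc n)"
    and "(\<lambda>n. 1 / real (a (Suc n))) sums lam"
  shows "liminf (\<lambda>n. ereal (real (a n) powr (1 / 2 ^ n)))
           < ereal (lim (\<lambda>n. real (b n) powr (1 / 2 ^ n)))
         \<or> (\<forall>\<^sub>F n in sequentially. a n = b n)"
proof (subst disj_commute, rule disjCI)
  assume ge_lim: "\<not> liminf (\<lambda>n. ereal (real (a n) powr (1 / 2 ^ n)))
           < ereal (lim (\<lambda>n. real (b n) powr (1 / 2 ^ n)))"
  obtain L where L: "0 < L" "(\<lambda>n. real (b n) powr (1 / 2 ^ n)) \<longlonglongrightarrow> L"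
    using eventually_greedy_best_limit[OF assms(3)] by blast
  define l where "l = ln L"
  have a_large: "\<forall>\<^sub>F n in sequentially. exp ((l - e) * 2 ^ n) \<le> real (a n)" if "0 < e" for e
    unfolding l_def using L(1) ge_lim that unfolding limI[OF L(2)] not_less by (rule liminf_lower_bound)
  obtain N T0 where T0: "2 \<le> T0" and lam: "lam = usum b N + 1 / real T0"
    and b: "\<And>j. b (N + j + 1) = greedy_tail T0 j + 1"
    and best: "\<And>n. N \<le> n \<Longrightarrow> usum b n = best_under n lam"
    using assms(3) unfolding eventually_greedy_best_def by blast
  \<comment> \<open>The subtraction is truncated; \<open>1 / t n\<close> is the remainder of
    \<open>b\<close> after \<open>n\<close> terms once \<open>N \<le> n\<close>.\<close>
  define t where "t n = greedy_tail T0 (n - N)" for n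
  have bt: "b (Suc n) = t n + 1" if "N \<le> n" for n
    using b[of "n - N"] that by (simp add: t_def)
  have t2: "2 \<le> real (t n)" for n using greedy_tail_ge[OF T0, of "n - N"] by (simp add: t_def)
  have tSuc: "t (Suc n) = t n * (t n + 1)" if "N \<le> n" for n
    using that by (simp add: t_def Suc_diff_le)
  have t_less: "ln (real (t n)) < l * 2 ^ Suc n" if "N \<le> n" for n
    using greedy_tail_less_limit[OF T0 b L, of "n - N"] that by (simp add: t_def l_def)
  have "0 < ln (real (t N))" using t2[of N] by simp
  also have "\<dots> < l * 2 ^ Suc N" by (rule t_less) simp
  finally have l: "0 < l" by (simp add: zero_less_mult_iff)
  have b_rem: "lam - usum b n = 1 / real (t n)" if "N \<le> n" for n
    using that
  proof (induction n rule: dec_induct)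
    case base
    then show ?case by (simp add: lam t_def)
  next
    case (step n)
    have *: "1 / s - 1 / (s + 1) = 1 / (s * (s + 1))" if "0 < s" for s :: real
      using that by (simp add: divide_simps)
    have "lam - usum b (Suc n) = 1 / real (t n) - 1 / (real (t n) + 1)"
      using step bt[of n] by (simp add: usum_def algebra_simps)
    also have "\<dots> = 1 / real (t (Suc n))"
      using *[of "real (t n)"] t2[of n] tSuc[of n] step by (simp add: algebra_simps)
    finally show ?case .
  qed

  \<comment> \<open>Size of the remainders of the competing sequence\<close>
  have a_mono: "a i \<le> a j" if "1 \<le> i" "i \<le> j" for i j
    using that(2,1)
  proof (induction j rule: dec_induct)
    case (step n)
    then have "a n \<le> a (Suc n)" using assms(5) by simp
    with step show ?case by simp
  qed simp
  have a2: "2 \<le> a n" if "1 \<le> n" for n using a_mono[of 1 n] assms(4) that by simp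
  have in_denom: "a \<in> denom_tuples n" for n
    unfolding denom_tuples_def using a2 a_mono by auto
  define r where "r n = lam - usum a n" for n
  have r_rec: "r n = r (Suc n) + 1 / real (a (Suc n))" for n by (simp add: r_def usum_def)
  have "usum a = (\<lambda>n. \<Sum>i<n. 1 / real (a (Suc i)))"
    by (simp add: usum_def fun_eq_iff sum.atLeast1_atMost_eq)
  with assms(6) have "usum a \<longlonglongrightarrow> lam" by (simp add: sums_def)
  from tendsto_diff[OF tendsto_const[of lam] this] have r_lim: "r \<longlonglongrightarrow> 0"
    by (simp add: r_def[abs_def])
  have "r (Suc n) < r n" for n using r_rec[of n] a2[of "Suc n"] by simp
  then have r_dec: "decseq r" "\<And>n. r (Suc n) < r n" by (auto intro: decseq_SucI less_imp_le)
  have r_pos: "0 < r n" for n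
    using decseq_ge[OF r_dec(1) r_lim, of "Suc n"] r_dec(2)[of n] by simp
  define x where "x n = 1 / r n" for n
  have x_pos: "0 < x n" for n using r_pos[of n] by (simp add: x_def)
  have x_le: "x n \<le> real (t n)" if "N \<le> n" for n
  proof -
    \<comment> \<open>As \<open>r n\<close> is positive, the first \<open>n\<close> terms of
      \<open>a\<close> are admissible in \<open>best_under n lam\<close>.\<close>
    have "usum a n \<le> usum b n"
      using best_under_max(2)[OF assms(2) in_denom] r_pos[of n] best[OF that] by (simp add: r_def)
    then have "1 / real (t n) \<le> r n" using b_rem[OF that] by (simp add: r_def)
    then show ?thesis using t2[of n] r_pos[of n] by (simp add: x_def field_simps)
  qed

  define y where "y n = ln (x n)" for n
  have upper: "y n \<le> l * 2 ^ Suc n" if "N \<le> n" for n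
  proof -
    have "y n \<le> ln (real (t n))" unfolding y_def using x_le[OF that] x_pos by (intro ln_mono) auto
    with t_less[OF that] show ?thesis by simp
  qed
  \<comment> \<open>The condition \<open>e < l\<close> makes the exponent \<open>l - e / 2\<close>
    positive, as the tail bound requires. The remaining \<open>e / 2\<close> absorbs the factor 2 of
    that bound.\<close>
  have lower_small: "\<forall>\<^sub>F n in sequentially. (l - e) * 2 ^ Suc n \<le> y n" if e: "0 < e" "e < l" for e
  proof -
    have big: "\<forall>\<^sub>F n in sequentially. exp ((l - e / 2) * 2 ^ n) \<le> real (a n)" by (rule a_large) (use e in simp)
    have "\<forall>\<^sub>F n in sequentially. r n \<le> 2 * exp (- ((l - e / 2) * 2 ^ Suc n))"
      by (rule double_exp_tail_bound[OF _ r_rec r_lim big]) (use e in simp)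
    moreover have "\<forall>\<^sub>F n in sequentially. ln 2 < e * 2 ^ n"
      by (rule eventually_const_less_double_exp) fact
    ultimately show ?thesis
    proof eventually_elim
      case (elim n)
      have "ln (r n) \<le> ln (2 * exp (- ((l - e / 2) * 2 ^ Suc n)))"
        using elim(1) r_pos[of n] by (intro ln_mono) auto
      also have "\<dots> = ln 2 - (l - e / 2) * 2 ^ Suc n" by (simp add: ln_mult)
      finally show ?case using elim(2) r_pos[of n] by (simp add: y_def x_def ln_div algebra_simps)
    qed
  qed
  have lower: "\<forall>\<^sub>F n in sequentially. (l - e) * 2 ^ Suc n \<le> y n" if "0 < e" for e
  proof -
    have "\<forall>\<^sub>F n in sequentially. (l - min e (l / 2)) * 2 ^ Suc n \<le> y n"
      by (rule lower_small) (use that l in auto)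
    then show ?thesis
    proof eventually_elim
      case (elim n)
      have "(l - e) * 2 ^ Suc n \<le> (l - min e (l / 2)) * 2 ^ Suc n" by (intro mult_right_mono) auto
      with elim show ?case by linarith
    qed
  qed

  have a_close: "\<forall>\<^sub>F n in sequentially. ln (real (a (Suc n))) \<le> y n + 2 * exp (- (l * 2 ^ n))"
  proof -
    \<comment> \<open>With \<open>l / 4\<close> one gets
      \<open>y (Suc n) \<ge> 3 * l * 2 ^ n\<close>, whereas \<open>y n \<le> 2 * l * 2 ^ n\<close>;
      the difference bounds \<open>ln q\<close> by \<open>- (l * 2 ^ n)\<close>.\<close>
    have "\<forall>\<^sub>F n in sequentially. (l - l / 4) * 2 ^ Suc n \<le> y n" by (rule lower) (use l in simp)
    then have "\<forall>\<^sub>F n in sequentially. (l - l / 4) * 2 ^ Suc (Suc n) \<le> y (Suc n)"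
      by (subst eventually_sequentially_Suc)
    moreover have "\<forall>\<^sub>F n in sequentially. ln 2 < l * 2 ^ n"
      by (rule eventually_const_less_double_exp) fact
    ultimately show ?thesis using eventually_ge_at_top[of N]
    proof eventually_elim
      case (elim n)
      \<comment> \<open>This is the ratio \<open>r (Suc n) / r n\<close> of successive remainders,
        so \<open>a (Suc n) = x n / (1 - q)\<close>.\<close>
      define q where "q = x n / x (Suc n)"
      have "0 < q" using x_pos by (simp add: q_def)
      have "ln q = y n - y (Suc n)" using x_pos[of n] x_pos[of "Suc n"] by (simp add: q_def y_def ln_div)
      also have "\<dots> \<le> - (l * 2 ^ n)" using elim(1) upper[OF elim(3)] by simp
      finally have "exp (ln q) \<le> exp (- (l * 2 ^ n))" by (subst exp_le_cancel_iff)
      then have q: "q \<le> exp (- (l * 2 ^ n))" using \<open>0 < q\<close> by simp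
      also have "\<dots> < exp (- ln 2)" using elim(2) by simp
      also have "\<dots> = 1 / 2" by (simp add: exp_minus)
      finally have "q < 1 / 2" .
      have "(1 - q) / x n = r n - r (Suc n)"
        using r_pos[of n] by (simp add: q_def x_def left_diff_distrib)
      also have "\<dots> = 1 / real (a (Suc n))" using r_rec[of n] by linarith
      finally have inv: "1 / real (a (Suc n)) = (1 - q) / x n" by (rule sym)
      have "real (a (Suc n)) = 1 / (1 / real (a (Suc n)))" by simp
      also have "\<dots> = x n / (1 - q)" unfolding inv by simp
      finally have "ln (real (a (Suc n))) = y n - ln (1 - q)"
        using x_pos[of n] \<open>q < 1 / 2\<close> by (simp add: y_def ln_div)
      moreover have "- ln (1 - q) \<le> 2 * q"
      proof -
        have "- ln (1 - q) = ln (1 / (1 - q))" using \<open>q < 1 / 2\<close> by (simp add: ln_div)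
        also have "\<dots> \<le> 1 / (1 - q) - 1" using \<open>q < 1 / 2\<close> by (intro ln_le_minus_one) simp
        also have "\<dots> \<le> 2 * q" using \<open>0 < q\<close> \<open>q < 1 / 2\<close> by (simp add: field_simps)
        finally show ?thesis .
      qed
      ultimately show ?case using q by linarith
    qed
  qed

  \<comment> \<open>Integer numerators of the remainders\<close>
  obtain d :: nat where d: "0 < d" "real d * lam \<in> \<int>"
  proof -
    obtain i n :: int where "0 < n" "lam = of_int i / of_int n"
      using assms(1) by (rule Rats_cases')
    then show thesis using that[of "nat n"] by simp
  qed
  define Q where "Q n = real d * real (\<Prod>i=1..n. a i)" for n
  have Q_pos: "0 < Q n" for n
    unfolding Q_def using d(1) a2 by (force intro!: mult_pos_pos prod_pos simp: of_nat_prod)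
  \<comment> \<open>The witness is \<open>Q n * r n\<close>: the factor \<open>d\<close> clears the
    denominator of \<open>lam\<close>, and the product clears those in
    \<open>usum a n\<close>.\<close>
  have "\<exists>p::nat. 0 < p \<and> real p * x n = Q n" for n
  proof -
    have "Q n * r n = real (\<Prod>i=1..n. a i) * (real d * lam)
        - real d * (real (\<Prod>i=1..n. a i) * usum a n)"
      by (simp add: Q_def r_def algebra_simps)
    also have "\<dots> \<in> \<int>"
      by (rule Ints_diff[OF Ints_mult[OF _ d(2)] Ints_mult[OF _ prod_mult_usum_Ints]])
        (use a2 in force)+
    finally obtain p :: int where p: "Q n * r n = of_int p" by (elim Ints_cases)
    moreover have "0 < Q n * r n" using Q_pos r_pos by simp
    ultimately have "0 < p" by simp
    then have "0 < nat p" "real (nat p) * x n = Q n"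
      using p r_pos[of n] by (auto simp: x_def field_simps)
    then show ?thesis by blast
  qed
  then obtain P :: "nat \<Rightarrow> nat" where P: "\<And>n. 0 < P n" "\<And>n. real (P n) * x n = Q n" by metis
  have P_rec: "real (P (Suc n)) * x (Suc n) = real (P n) * x n * real (a (Suc n))" for n
    unfolding P(2) by (simp add: Q_def)
  have "\<exists>m. \<forall>\<^sub>F n in sequentially. P n = m"
  proof (rule eventually_constant_numerator[OF l P(1) _ _ lower])
    show "\<forall>\<^sub>F n in sequentially. y n \<le> l * 2 ^ Suc n"
      using upper unfolding eventually_sequentially by blast
    show "\<forall>\<^sub>F n in sequentially. ln (real (P (Suc n))) + y (Suc n)
        \<le> ln (real (P n)) + 2 * y n + 2 * exp (- (l * 2 ^ n))"
      using a_close
    proof eventually_elim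
      case (elim n)
      have "ln (real (P (Suc n))) + y (Suc n) = ln (real (P (Suc n)) * x (Suc n))"
        using P(1)[of "Suc n"] x_pos[of "Suc n"] by (simp add: y_def ln_mult)
      also have "\<dots> = ln (real (P n)) + y n + ln (real (a (Suc n)))"
        unfolding P_rec using P(1)[of n] x_pos[of n] a2[of "Suc n"] by (simp add: y_def ln_mult)
      finally show ?case using elim by simp
    qed
  qed
  then obtain m where "\<forall>\<^sub>F n in sequentially. P n = m" by blast
  from eventually_conj[OF this eventually_ge_at_top[of N]]
  obtain K where K: "N \<le> K" "\<And>n. K \<le> n \<Longrightarrow> P n = m"
    unfolding eventually_sequentially by blast

  \<comment> \<open>Identification with the greedy recursion\<close>
  have x_Suc: "x (Suc n) = x n * real (a (Suc n))" if "K \<le> n" for n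
    using P_rec[of n] K(2)[of n] K(2)[of "Suc n"] that P(1)[of n] by simp
  have a_x: "real (a (Suc n)) = x n + 1" if "K \<le> n" for n
  proof -
    have "1 / x n = 1 / x (Suc n) + 1 / real (a (Suc n))" using r_rec[of n] by (simp add: x_def)
    \<comment> \<open>Multiplying by \<open>x n * a (Suc n) = x (Suc n)\<close> turns the identity
      of reciprocals into \<open>a (Suc n) = 1 + x n\<close>.\<close>
    then show ?thesis unfolding x_Suc[OF that] using x_pos[of n] a2[of "Suc n"] by (simp add: field_simps)
  qed
  have "x K = real (t K)"
  proof (rule ccontr)
    assume "x K \<noteq> real (t K)"
    with x_le[OF K(1)] have "x K < real (t K)" by simp
    with a_x[of K] have "real (a (Suc K)) < real (t K + 1)" by simp
    then have aK: "a (Suc K) \<le> t K" by linarith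
    \<comment> \<open>Each later term is at most the square of the one before, so the integer bound
      \<open>a (Suc K) \<le> t K\<close> caps the growth exponent of \<open>a\<close> at
      \<open>ln (t K) / 2 ^ Suc K\<close>, which is strictly below \<open>l\<close>.\<close>
    have decay: "ln (real (a (Suc K + i))) \<le> 2 ^ i * ln (real (t K))" for i
    proof (induction i)
      case 0
      show ?case using aK a2[of "Suc K"] by (auto intro!: ln_mono)
    next
      case (Suc i)
      let ?n = "K + i"
      have "real (a (Suc (Suc ?n))) = x ?n * (x ?n + 1) + 1"
        using a_x[of ?n] a_x[of "Suc ?n"] x_Suc[of ?n] by simp
      also have "\<dots> \<le> (x ?n + 1)\<^sup>2" using x_pos[of ?n] by (simp add: power2_eq_square algebra_simps)
      also have "\<dots> = (real (a (Suc ?n)))\<^sup>2" using a_x[of ?n] by simp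
      finally have "ln (real (a (Suc (Suc ?n)))) \<le> ln ((real (a (Suc ?n)))\<^sup>2)"
        using a2[of "Suc (Suc ?n)"] by (intro ln_mono) auto
      also have "\<dots> = 2 * ln (real (a (Suc ?n)))" using a2[of "Suc ?n"] by (simp add: ln_realpow)
      finally show ?case using Suc by simp
    qed
    \<comment> \<open>This is half of the gap between \<open>l\<close> and
      \<open>ln (t K) / 2 ^ Suc K\<close>.\<close>
    define e where "e = (l * 2 ^ Suc K - ln (real (t K))) / 2 ^ Suc (Suc K)"
    have "0 < e" using t_less[OF K(1)] by (simp add: e_def)
    from a_large[OF this] obtain M where M: "\<And>n. M \<le> n \<Longrightarrow> exp ((l - e) * 2 ^ n) \<le> real (a n)"
      by (auto simp: eventually_sequentially)
    have "(l - e) * 2 ^ (Suc K + M) = ln (exp ((l - e) * 2 ^ (Suc K + M)))" by simp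
    also have "\<dots> \<le> ln (real (a (Suc K + M)))" by (intro ln_mono M) auto
    also have "\<dots> \<le> 2 ^ M * ln (real (t K))" by (rule decay)
    finally have "2 ^ M * ((l - e) * 2 ^ Suc K) \<le> 2 ^ M * ln (real (t K))"
      by (simp add: power_add algebra_simps)
    then have "(l - e) * 2 ^ Suc K \<le> ln (real (t K))" by simp
    then show False using t_less[OF K(1)] by (simp add: e_def field_simps)
  qed
  have x_eq: "x n = real (t n)" if "K \<le> n" for n
    using that
  proof (induction n rule: dec_induct)
    case (step n)
    then show ?case using x_Suc[of n] a_x[of n] tSuc[of n] K(1) by (simp add: distrib_left)
  qed fact
  have "a (Suc n) = b (Suc n)" if "K \<le> n" for n
    using a_x[OF that] x_eq[OF that] bt[of n] K(1) that by simp
  then have "\<forall>\<^sub>F n in sequentially. a (Suc n) = b (Suc n)" unfolding eventually_sequentially by blast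
  then show "\<forall>\<^sub>F n in sequentially. a n = b n" by (subst (asm) eventually_sequentially_Suc)
qed

end
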